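(* Let $r,s$ be positive integers and $G=\mathbb{Z}_2^r\times\mathbb{Z}_4^s$. The Laplacian polynomial of the power graph $\mathcal{G}(G)$ is \[x(x-1)^{2^{r+s}-2}(x-2)^{(2^s-1)(2^{r+s-1}-1)}(x-4)^{2^{r+s-1}(2^s-1)}(x-2-2^{r+s})^{2^s-1}(x-2^{r+2s}).\]
   Context: For a finite group $G$, the power graph $\mathcal{G}(G)$ is the simple graph with vertex set $G$ in which two distinct vertices are adjacent if and only if one is a power of the other. $\mathbb{Z}_k^t$ denotes the direct product of $t$ copies of the cyclic group $\mathbb{Z}_k$. The Laplacian polynomial of a finite simple graph $\Gamma$ is $\det(xI-L(\Gamma))$, where $L(\Gamma)=D(\Gamma)-A(\Gamma)$ is the degree diagonal matrix minus the adjacency matrix. *)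

theory Defs
  imports
    "HOL-Algebra.Product_Groups"
    "HOL-Algebra.Elementary_Groups"
    "Graph_Theory.Pair_Digraph"
    "Jordan_Normal_Form.Char_Poly"
begin

text \<open>A simple graph is a \<^locale>\<open>pair_graph\<close>: finite, loop-free and with a symmetric arc relation.
  Natural exponents suffice for ``is a power of'' because the groups considered are finite.\<close>

definition power_graph :: "('a, 'b) monoid_scheme \<Rightarrow> 'a pair_pre_digraph" where
  "power_graph G = \<lparr> pverts = carrier G,
     parcs = {(x, y). x \<in> carrier G \<and> y \<in> carrier G \<and> x \<noteq> y \<and>
       ((\<exists>n::nat. y = x [^]\<^bsub>G\<^esub> n) \<or> (\<exists>n::nat. x = y [^]\<^bsub>G\<^esub> n))} \<rparr>"

lemma pair_graph_power_graph:
  assumes "finite (carrier G)"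
  shows "pair_graph (power_graph G)"
proof -
  have "parcs (power_graph G) \<subseteq> carrier G \<times> carrier G"
    by (auto simp: power_graph_def)
  then have "finite (parcs (power_graph G))"
    using assms by (meson finite_SigmaI finite_subset)
  then show ?thesis
    using assms
    by unfold_locales (auto simp: power_graph_def symmetric_def with_proj_simps intro!: symI)
qed

definition cyclic_power :: "nat \<Rightarrow> nat \<Rightarrow> (nat \<Rightarrow> int) monoid" where
  "cyclic_power k t = product_group {..<t} (\<lambda>_. integer_mod_group k)"

lemma group_cyclic_power: "group (cyclic_power k t)"
  by (simp add: cyclic_power_def)

lemma finite_carrier_cyclic_power: "k > 0 \<Longrightarrow> finite (carrier (cyclic_power k t))"
  by (simp add: cyclic_power_def carrier_integer_mod_group finite_PiE)

text \<open>The matrices of a graph are indexed by positions in a list \<open>vs\<close> enumerating the vertices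
  without repetition.  In a symmetric arc relation the degree of a vertex is its out-degree.\<close>

definition adjacency_mat :: "'a pair_pre_digraph \<Rightarrow> 'a list \<Rightarrow> real mat" where
  "adjacency_mat \<Gamma> vs = mat (length vs) (length vs)
     (\<lambda>(i, j). if (vs ! i, vs ! j) \<in> parcs \<Gamma> then 1 else 0)"

definition degree_mat :: "'a pair_pre_digraph \<Rightarrow> 'a list \<Rightarrow> real mat" where
  "degree_mat \<Gamma> vs = mat (length vs) (length vs)
     (\<lambda>(i, j). if i = j then real (out_degree (with_proj \<Gamma>) (vs ! i)) else 0)"

definition laplacian_mat :: "'a pair_pre_digraph \<Rightarrow> 'a list \<Rightarrow> real mat" where
  "laplacian_mat \<Gamma> vs = degree_mat \<Gamma> vs - adjacency_mat \<Gamma> vs"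

definition laplacian_poly :: "'a pair_pre_digraph \<Rightarrow> 'a list \<Rightarrow> real poly" where
  "laplacian_poly \<Gamma> vs = char_poly (laplacian_mat \<Gamma> vs)"

end

theory Submission
  imports Defs
begin

text \<open>Evaluate the characteristic polynomial of the Laplacian at a generic real \<open>X\<close> and take Schur
  complements twice.  In an abelian group of exponent 4 the elements of order 4 come in pairs
  \<open>{x, inv x}\<close> of adjacent twins, each joined only to \<open>x\<^sup>2\<close> and to the identity, so their block is a
  sum of two-by-two blocks.  Once they are eliminated, the remaining matrix on the two-torsion couples
  each involution only to the identity; eliminating the involutions leaves a single entry.  All
  multiplicities come from the fact that every square of an element of order 4 has as many square
  roots as there are elements in the two-torsion.\<close>

subsection \<open>Determinants indexed by finite sets\<close>

text \<open>Rows and columns carry labels from lists, so concatenating label lists gives a block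
  decomposition.\<close>

definition kernel_mat :: "'a list \<Rightarrow> 'b list \<Rightarrow> ('a \<Rightarrow> 'b \<Rightarrow> 'c) \<Rightarrow> 'c mat" where
  "kernel_mat xs ys f = mat (length xs) (length ys) (\<lambda>(i, j). f (xs ! i) (ys ! j))"

lemma kernel_mat_carrier [simp]: "kernel_mat xs ys f \<in> carrier_mat (length xs) (length ys)"
  and dim_row_kernel_mat [simp]: "dim_row (kernel_mat xs ys f) = length xs"
  and dim_col_kernel_mat [simp]: "dim_col (kernel_mat xs ys f) = length ys"
  and index_kernel_mat [simp]: "i < length xs \<Longrightarrow> j < length ys \<Longrightarrow>
    kernel_mat xs ys f $$ (i, j) = f (xs ! i) (ys ! j)"
  by (simp_all add: kernel_mat_def)

lemma kernel_mat_append: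
  "kernel_mat (xs @ ys) (us @ vs) f =
     four_block_mat (kernel_mat xs us f) (kernel_mat xs vs f) (kernel_mat ys us f) (kernel_mat ys vs f)"
  by (rule eq_matI) (auto simp: nth_append)

lemma kernel_mat_mult:
  fixes f :: "'a \<Rightarrow> 'b \<Rightarrow> 'c :: comm_semiring_0"
  assumes "distinct ys"
  shows "kernel_mat xs ys f * kernel_mat ys zs g =
    kernel_mat xs zs (\<lambda>x z. \<Sum>y\<in>set ys. f x y * g y z)"
proof (rule eq_matI; simp)
  fix i j assume "i < length xs" "j < length zs"
  then show "row (kernel_mat xs ys f) i \<bullet> col (kernel_mat ys zs g) j =
      (\<Sum>y\<in>set ys. f (xs ! i) y * g y (zs ! j))"
    using assms by (simp add: scalar_prod_def sum.distinct_set_conv_list sum_list_sum_nth)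
qed

text \<open>Changing the enumeration applies one permutation to the rows and again to the columns,
  so its sign enters twice and cancels. This makes \<open>det_on\<close> independent of the chosen
  list.\<close>

lemma det_kernel_mat_enumeration:
  fixes f :: "'a \<Rightarrow> 'a \<Rightarrow> 'b :: comm_ring_1"
  assumes "distinct xs" "distinct ys" "set xs = set ys"
  shows "det (kernel_mat xs xs f) = det (kernel_mat ys ys f)"
proof -
  have "mset xs = mset ys"
    using assms set_eq_iff_mset_eq_distinct by blast
  then obtain p where p: "p permutes {..<length ys}" "permute_list p ys = xs"
    by (rule mset_eq_permutation)
  let ?n = "length ys"
  have p0: "p permutes {0..<?n}"
    using p(1) by (simp add: atLeast0LessThan)
  have len: "length xs = ?n" using p(2) by auto
  have nth: "xs ! i = ys ! p i" if "i < ?n" for i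
    using p that permute_list_nth by metis
  have plt: "p i < ?n" if "i < ?n" for i
    using p(1) that by (metis lessThan_iff permutes_in_image)
  let ?M = "kernel_mat xs ys f"
  have M: "?M \<in> carrier_mat ?n ?n" using len kernel_mat_carrier by metis
  have "?M = mat ?n ?n (\<lambda>(i, j). kernel_mat ys ys f $$ (p i, j))"
    by (rule eq_matI) (auto simp: len nth plt)
  then have 1: "det ?M = signof p * det (kernel_mat ys ys f)"
    using det_permute_rows[OF kernel_mat_carrier p0] by simp
  have "transpose_mat (kernel_mat xs xs f) = mat ?n ?n (\<lambda>(i, j). transpose_mat ?M $$ (p i, j))"
    by (rule eq_matI) (auto simp: len nth plt)
  then have "det (kernel_mat xs xs f) = signof p * det (transpose_mat ?M)"
    using det_permute_rows[OF transpose_carrier_mat[THEN iffD2, OF M] p0] det_transpose[OF kernel_mat_carrier]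
    by metis
  then have "det (kernel_mat xs xs f) = signof p * (signof p * det (kernel_mat ys ys f))"
    using 1 det_transpose[OF M] by simp
  then show ?thesis
    by (simp add: sign_def split: if_splits)
qed

text \<open>Meaningful for finite \<open>S\<close> only: an infinite set has no enumerating list,
  and the choice is then unspecified.\<close>

definition det_on :: "'a set \<Rightarrow> ('a \<Rightarrow> 'a \<Rightarrow> 'b :: comm_ring_1) \<Rightarrow> 'b" where
  "det_on S f = (let xs = (SOME xs. distinct xs \<and> set xs = S) in det (kernel_mat xs xs f))"

lemma det_on_set: "distinct xs \<Longrightarrow> det_on (set xs) f = det (kernel_mat xs xs f)"
  unfolding det_on_def Let_def
  by (rule someI2[of _ xs]) (auto intro: det_kernel_mat_enumeration)

lemma det_on_empty [simp]: "det_on {} f = 1"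
  using det_on_set[of "[]" f] det_dim_zero[of "kernel_mat [] [] f"] by (simp add: kernel_mat_def)

lemma det_on_singleton [simp]: "det_on {x} f = f x x"
  using det_on_set[of "[x]" f] det_single[of "kernel_mat [x] [x] f"] by (simp add: kernel_mat_def)

text \<open>Here \<open>g\<close> stands for the inverse of the \<open>A\<close>-block times the
  \<open>A\<close>-\<open>B\<close> block. It is described by the linear system that it solves, so
  each use only has to exhibit a solution.\<close>

theorem det_on_schur_complement:
  fixes f g :: "'a \<Rightarrow> 'a \<Rightarrow> 'b :: idom"
  assumes fin: "finite A" "finite B" and disj: "A \<inter> B = {}"
    and g: "\<And>x z. x \<in> A \<Longrightarrow> z \<in> B \<Longrightarrow> (\<Sum>y\<in>A. f x y * g y z) = f x z"
  shows "det_on (A \<union> B) f = det_on A f * det_on B (\<lambda>x z. f x z - (\<Sum>y\<in>A. f x y * g y z))"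
proof -
  obtain xs ys where xs: "distinct xs" "set xs = A" and ys: "distinct ys" "set ys = B"
    using finite_distinct_list fin by metis
  let ?S = "\<lambda>x z. f x z - (\<Sum>y\<in>A. f x y * g y z)"
  let ?n = "length xs" and ?m = "length ys"
  let ?L = "four_block_mat (kernel_mat xs xs f) (0\<^sub>m ?n ?m) (kernel_mat ys xs f) (kernel_mat ys ys ?S)"
  let ?U = "four_block_mat (1\<^sub>m ?n) (kernel_mat xs ys g) (0\<^sub>m ?m ?n) (1\<^sub>m ?m)"
  have eq1: "kernel_mat xs ys f = kernel_mat xs xs f * kernel_mat xs ys g"
    by (rule eq_matI) (use xs ys g nth_mem in \<open>auto simp: kernel_mat_mult simp del: index_mult_mat(1)\<close>)
  have eq2: "kernel_mat ys ys f = kernel_mat ys xs f * kernel_mat xs ys g + kernel_mat ys ys ?S"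
    by (rule eq_matI) (use xs in \<open>auto simp: kernel_mat_mult simp del: index_mult_mat(1)\<close>)
  \<comment> \<open>Block LU factorization: the lower factor carries the \<open>A\<close>-block and
    the Schur complement on its diagonal, the upper factor is unitriangular.\<close>
  have "kernel_mat (xs @ ys) (xs @ ys) f = ?L * ?U"
    unfolding kernel_mat_append
    by (subst mult_four_block_mat[of _ ?n ?n _ ?m _ ?m _ _ ?n _ ?m]) (auto simp: eq1 eq2)
  moreover have "det ?L = det_on A f * det_on B ?S"
    unfolding det_on_set[OF xs(1), unfolded xs(2)] det_on_set[OF ys(1), unfolded ys(2)]
    by (rule det_four_block_mat_upper_right_zero[OF kernel_mat_carrier refl kernel_mat_carrier kernel_mat_carrier])
  moreover have "det ?U = 1"
    using det_four_block_mat_lower_left_zero[of "1\<^sub>m ?n :: 'b mat" ?n "kernel_mat xs ys g" ?m "0\<^sub>m ?m ?n" "1\<^sub>m ?m"]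
    by simp
  ultimately have "det (kernel_mat (xs @ ys) (xs @ ys) f) = det_on A f * det_on B ?S"
    using det_mult[of ?L "?n + ?m" ?U] by simp
  then show ?thesis
    using det_on_set[of "xs @ ys" f] xs ys disj by simp
qed

lemma det_on_block_diagonal:
  fixes f :: "'a \<Rightarrow> 'a \<Rightarrow> 'b :: idom"
  assumes "finite A" "finite B" "A \<inter> B = {}"
    and "\<And>x z. x \<in> A \<Longrightarrow> z \<in> B \<Longrightarrow> f x z = 0"
  shows "det_on (A \<union> B) f = det_on A f * det_on B f"
  using det_on_schur_complement[of A B f "\<lambda>_ _. 0"] assms by simp

lemma det_on_diagonal:
  fixes f :: "'a \<Rightarrow> 'a \<Rightarrow> 'b :: idom"
  assumes "finite A" and "\<And>x y. x \<in> A \<Longrightarrow> y \<in> A \<Longrightarrow> x \<noteq> y \<Longrightarrow> f x y = 0"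
  shows "det_on A f = (\<Prod>x\<in>A. f x x)"
  using assms
proof (induction A rule: finite_induct)
  case (insert a A)
  then have "det_on ({a} \<union> A) f = det_on {a} f * det_on A f"
    by (intro det_on_block_diagonal) auto
  with insert show ?case by simp
qed simp

text \<open>A Schur complement with pivot \<open>f x x\<close>; the one-by-one system is solved by
  \<open>f x y / f x x\<close>.\<close>

lemma det_on_pair:
  fixes f :: "'a \<Rightarrow> 'a \<Rightarrow> 'b :: field"
  assumes "x \<noteq> y" and "f x x \<noteq> 0"
  shows "det_on {x, y} f = f x x * f y y - f x y * f y x"
  using det_on_schur_complement[of "{x}" "{y}" f "\<lambda>_ _. f x y / f x x"] assms
  by (simp add: right_diff_distrib insert_commute mult.commute)

text \<open>A fixed-point-free involution splits \<open>A\<close> into \<open>h\<close> uncoupled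
  pairs, each a two-by-two block with \<open>a\<close> on and \<open>b\<close> off the diagonal. The
  pairs are split off one at a time, with \<open>a\<close> as pivot.\<close>

lemma det_on_involution:
  fixes f :: "'a \<Rightarrow> 'a \<Rightarrow> 'b :: field"
  assumes "finite A" and "a \<noteq> 0"
    and inv: "\<And>x. x \<in> A \<Longrightarrow> \<iota> x \<in> A \<and> \<iota> (\<iota> x) = x \<and> \<iota> x \<noteq> x"
    and f: "\<And>x y. x \<in> A \<Longrightarrow> y \<in> A \<Longrightarrow> f x y = (if y = x then a else if y = \<iota> x then b else 0)"
    and "card A = 2 * h"
  shows "det_on A f = (a\<^sup>2 - b\<^sup>2) ^ h"
  using assms
proof (induction h arbitrary: A)
  case (Suc h)
  then obtain x where x: "x \<in> A" by fastforce
  let ?P = "{x, \<iota> x}"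
  have P: "?P \<subseteq> A" "\<iota> x \<noteq> x" "\<iota> (\<iota> x) = x" using Suc.prems(3)[OF x] x by auto
  have stable: "\<iota> y \<notin> ?P" if "y \<in> A - ?P" for y
    using that Suc.prems(3)[of y] P by auto
  have "det_on (?P \<union> (A - ?P)) f = det_on ?P f * det_on (A - ?P) f"
    using P Suc.prems(1) by (intro det_on_block_diagonal) (auto simp: Suc.prems(4))
  moreover have "det_on ?P f = a\<^sup>2 - b\<^sup>2"
    using P x Suc.prems(2) by (subst det_on_pair) (auto simp: Suc.prems(4) power2_eq_square)
  moreover have "det_on (A - ?P) f = (a\<^sup>2 - b\<^sup>2) ^ h"
  proof (rule Suc.IH)
    show "card (A - ?P) = 2 * h"
      using Suc.prems(1,5) P by (simp add: card_Diff_subset)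
  qed (use Suc.prems stable in auto)
  moreover have "?P \<union> (A - ?P) = A" using P by auto
  ultimately show ?case by simp
qed simp

subsection \<open>Power graphs of abelian groups of exponent 4\<close>

text \<open>In \<open>X I - D + A\<close> the adjacency entries appear with a plus sign, and
  irreflexivity keeps them off the diagonal.\<close>

lemma poly_laplacian_poly:
  assumes "distinct vs" and "irrefl (parcs \<Gamma>)"
  shows "poly (laplacian_poly \<Gamma> vs) X = det_on (set vs)
    (\<lambda>x y. if x = y then X - real (card {z. (x, z) \<in> parcs \<Gamma>})
            else if (x, y) \<in> parcs \<Gamma> then 1 else 0)"
proof -
  have "out_arcs (with_proj \<Gamma>) x = Pair x ` {z. (x, z) \<in> parcs \<Gamma>}" for x
    by (auto simp: out_arcs_def with_proj_simps)
  then have deg: "out_degree (with_proj \<Gamma>) x = card {z. (x, z) \<in> parcs \<Gamma>}" for x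
    by (simp add: out_degree_def card_image inj_on_def)
  have L: "laplacian_mat \<Gamma> vs \<in> carrier_mat (length vs) (length vs)"
    unfolding laplacian_mat_def adjacency_mat_def by (intro minus_carrier_mat mat_carrier)
  have "poly (laplacian_poly \<Gamma> vs) X = det (- (char_matrix (laplacian_mat \<Gamma> vs) X))"
    unfolding laplacian_poly_def
    by (rule char_poly_matrix[OF L])
  also have "- (char_matrix (laplacian_mat \<Gamma> vs) X) = kernel_mat vs vs
    (\<lambda>x y. if x = y then X - real (card {z. (x, z) \<in> parcs \<Gamma>})
            else if (x, y) \<in> parcs \<Gamma> then 1 else 0)"
    using assms(2)
    by (intro eq_matI) (auto simp: laplacian_mat_def degree_mat_def adjacency_mat_def char_matrix_def deg
      nth_eq_iff_index_eq[OF assms(1)] irrefl_def)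
  finally show ?thesis by (simp add: det_on_set[OF assms(1)])
qed

section \<open>Two-torsion and elements of order 4\<close>

locale exponent_4_group = comm_group G for G (structure) +
  assumes finite_carrier: "finite (carrier G)"
    and pow_4: "x \<in> carrier G \<Longrightarrow> x [^] (4::nat) = \<one>"
begin

definition two_torsion :: "'a set" where
  "two_torsion = {x \<in> carrier G. x \<otimes> x = \<one>}"

text \<open>Since every fourth power is trivial, failing to square to the identity means having
  order exactly 4.\<close>

abbreviation order_4 :: "'a set" where
  "order_4 \<equiv> carrier G - two_torsion"

definition square_roots :: "'a \<Rightarrow> 'a set" where
  "square_roots t = {y \<in> order_4. y \<otimes> y = t}"

definition squares :: "'a set" where
  "squares = (\<lambda>x. x \<otimes> x) ` order_4"

lemma two_torsionD [simp]: "x \<in> two_torsion \<Longrightarrow> x \<in> carrier G"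
  and one_two_torsion [simp]: "\<one> \<in> two_torsion"
  unfolding two_torsion_def by auto

lemma two_torsion_square: "x \<in> two_torsion \<Longrightarrow> x \<otimes> x = \<one>"
  unfolding two_torsion_def by auto

lemma square_square: "x \<in> carrier G \<Longrightarrow> (x \<otimes> x) \<otimes> (x \<otimes> x) = \<one>"
proof -
  assume x: "x \<in> carrier G"
  have "(x \<otimes> x) \<otimes> (x \<otimes> x) = x [^] Suc (Suc (Suc (Suc 0)))"
    using x by (simp add: m_assoc)
  also have "Suc (Suc (Suc (Suc 0))) = 4" by simp
  finally show ?thesis using pow_4[OF x] by simp
qed

lemma inv_eq_cube: "x \<in> carrier G \<Longrightarrow> inv x = x \<otimes> x \<otimes> x"
  using square_square[of x] by (intro inv_equality) (auto simp: m_assoc)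

text \<open>A square is its own inverse by \<open>square_square\<close>. Hence \<open>x\<close> and
  \<open>inv x\<close> are roots of the same involution, which later makes them twins.\<close>

lemma inv_square: "x \<in> carrier G \<Longrightarrow> inv x \<otimes> inv x = x \<otimes> x"
  using inv_equality[OF square_square[of x]] inv_mult[of x x] by simp

lemma inv_eq_self_iff: "x \<in> carrier G \<Longrightarrow> inv x = x \<longleftrightarrow> x \<in> two_torsion"
proof -
  assume x: "x \<in> carrier G"
  have "x \<otimes> x = \<one>" if "inv x = x"
    using r_inv[OF x] unfolding that .
  then show ?thesis using x inv_equality[of x x] unfolding two_torsion_def by blast
qed

lemma inv_order_4: "x \<in> order_4 \<Longrightarrow> inv x \<in> order_4 \<and> inv (inv x) = x \<and> inv x \<noteq> x"
  using inv_eq_self_iff[of x] inv_eq_self_iff[of "inv x"] by auto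

lemma square_in_two_torsion: "x \<in> carrier G \<Longrightarrow> x \<otimes> x \<in> two_torsion"
  unfolding two_torsion_def by (simp add: square_square)

lemma order_4_square_neq_one: "x \<in> order_4 \<Longrightarrow> x \<otimes> x \<noteq> \<one>"
  unfolding two_torsion_def by auto

section \<open>Adjacency and neighbourhoods in the power graph\<close>

lemma is_power_iff:
  assumes "x \<in> carrier G"
  shows "(\<exists>n::nat. y = x [^] n) \<longleftrightarrow> y \<in> {\<one>, x, x \<otimes> x, inv x}"
proof -
  have pow: "x [^] (0::nat) = \<one>" "x [^] (1::nat) = x" "x [^] (2::nat) = x \<otimes> x" "x [^] (3::nat) = inv x"
    using assms by (simp_all add: inv_eq_cube numeral_2_eq_2 numeral_3_eq_3)
  have reduce: "x [^] n = x [^] (n mod 4)" for n :: nat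
  proof -
    have "x [^] n = x [^] (4 * (n div 4) + n mod 4)" by simp
    also have "\<dots> = (x [^] (4::nat)) [^] (n div 4) \<otimes> x [^] (n mod 4)"
      using assms by (simp only: nat_pow_mult nat_pow_pow nat_pow_closed)
    also have "\<dots> = x [^] (n mod 4)" using assms by (simp add: pow_4)
    finally show ?thesis .
  qed
  have "n mod 4 \<in> {0, 1, 2, 3}" for n :: nat by auto
  then have "x [^] n \<in> {\<one>, x, x \<otimes> x, inv x}" for n :: nat
    unfolding reduce[of n] using pow by (metis insert_iff empty_iff)
  moreover have "\<exists>n::nat. y = x [^] n" if "y \<in> {\<one>, x, x \<otimes> x, inv x}"
    using that pow by (metis empty_iff insert_iff)
  ultimately show ?thesis by blast
qed

abbreviation adjacent :: "'a \<Rightarrow> 'a \<Rightarrow> bool" where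
  "adjacent x y \<equiv> (x, y) \<in> parcs (power_graph G)"

lemma adjacent_iff:
  "adjacent x y \<longleftrightarrow> x \<in> carrier G \<and> y \<in> carrier G \<and> x \<noteq> y \<and>
     (y \<in> {\<one>, x \<otimes> x, inv x} \<or> x \<in> {\<one>, y \<otimes> y, inv y})"
  by (auto simp: power_graph_def is_power_iff cong: conj_cong)

lemma adjacent_sym: "adjacent x y \<longleftrightarrow> adjacent y x"
  by (auto simp: adjacent_iff)

lemma adjacent_one: "adjacent \<one> y \<longleftrightarrow> y \<in> carrier G - {\<one>}"
  by (auto simp: adjacent_iff)

lemma adjacent_order_4: "x \<in> order_4 \<Longrightarrow> y \<in> order_4 \<Longrightarrow> adjacent x y \<longleftrightarrow> y = inv x"
  using inv_order_4[of x] inv_order_4[of y] square_in_two_torsion[of x] square_in_two_torsion[of y]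
  by (auto simp: adjacent_iff)

text \<open>The powers of \<open>t\<close> lie in the two-torsion, so \<open>t\<close> must be a
  power of \<open>y\<close>. The inverse of \<open>y\<close> has order 4 and \<open>t\<close> is not
  the identity, which leaves only the square of \<open>y\<close>.\<close>

lemma adjacent_two_torsion_order_4:
  assumes "t \<in> two_torsion - {\<one>}" "y \<in> order_4"
  shows "adjacent t y \<longleftrightarrow> y \<in> square_roots t"
proof -
  have "inv t = t" using assms(1) inv_eq_self_iff by auto
  moreover have "inv y \<in> order_4" using inv_order_4 assms by blast
  ultimately show ?thesis using assms
    by (auto simp: adjacent_iff square_roots_def two_torsion_square)
qed

lemma adjacent_two_torsion:
  assumes "t \<in> two_torsion - {\<one>}" "u \<in> two_torsion - {\<one>}"
  shows "\<not> adjacent t u"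
  using assms inv_eq_self_iff[of t] inv_eq_self_iff[of u] by (auto simp: adjacent_iff two_torsion_square)

lemma neighbours_one: "{y. adjacent \<one> y} = carrier G - {\<one>}"
  by (auto simp: adjacent_one)

lemma neighbours_two_torsion:
  assumes "t \<in> two_torsion - {\<one>}"
  shows "{y. adjacent t y} = insert \<one> (square_roots t)"
proof -
  have "adjacent t \<one>" using assms by (auto simp: adjacent_iff)
  moreover have "adjacent t y \<Longrightarrow> y \<in> carrier G" for y by (simp add: adjacent_iff)
  ultimately show ?thesis
    using assms adjacent_two_torsion adjacent_two_torsion_order_4 by (auto simp: square_roots_def) blast+
qed

lemma neighbours_order_4:
  assumes "x \<in> order_4"
  shows "{y. adjacent x y} = {\<one>, x \<otimes> x, inv x}"
proof -
  have "y \<in> {\<one>, x \<otimes> x, inv x}" if "adjacent x y" for y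
  proof -
    have "y \<in> carrier G" using that by (simp add: adjacent_iff)
    then consider "y = \<one>" | "y \<in> two_torsion - {\<one>}" | "y \<in> order_4" by blast
    then show ?thesis
    proof cases
      case 2
      then show ?thesis
        using that assms adjacent_sym[of x y] adjacent_two_torsion_order_4[of y x]
        by (simp add: square_roots_def)
    qed (use that assms adjacent_order_4 in auto)
  qed
  moreover have "x \<noteq> \<one>" "x \<noteq> x \<otimes> x" "x \<noteq> inv x"
    using assms inv_order_4[of x] square_in_two_torsion[of x] by auto
  then have "adjacent x y" if "y \<in> {\<one>, x \<otimes> x, inv x}" for y
    using that assms by (auto simp: adjacent_iff)
  ultimately show ?thesis by blast
qed

lemma card_neighbours_order_4:
  assumes "x \<in> order_4"
  shows "card {y. adjacent x y} = 3"
proof -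
  have "x \<otimes> x \<noteq> \<one>" "inv x \<noteq> x \<otimes> x" "inv x \<noteq> \<one>"
    using assms inv_order_4[OF assms] square_in_two_torsion[of x] one_two_torsion
      order_4_square_neq_one[OF assms]
    by (auto simp del: one_two_torsion)
  then show ?thesis by (simp add: neighbours_order_4[OF assms])
qed

section \<open>Counting squares and square roots\<close>

lemma finite_subsets [simp]: "finite two_torsion" "finite order_4" "finite (square_roots t)" "finite squares"
  using finite_carrier unfolding two_torsion_def square_roots_def squares_def by auto

lemma squares_subset: "squares \<subseteq> two_torsion - {\<one>}"
  using square_in_two_torsion order_4_square_neq_one by (auto simp: squares_def)

text \<open>The square roots of a given square form a coset of the two-torsion.\<close>

lemma card_square_roots:
  "card (square_roots t) = (if t \<in> squares then card two_torsion else 0)"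
proof (cases "t \<in> squares")
  case True
  then obtain x where x: "x \<in> order_4" "t = x \<otimes> x" by (auto simp: squares_def)
  have "square_roots t = (\<lambda>u. x \<otimes> u) ` two_torsion"
  proof (intro equalityI subsetI)
    fix y assume "y \<in> square_roots t"
    then have y: "y \<in> carrier G" "y \<otimes> y = x \<otimes> x" by (auto simp: square_roots_def x)
    have "(inv x \<otimes> y) \<otimes> (inv x \<otimes> y) = (inv x \<otimes> inv x) \<otimes> (y \<otimes> y)"
      using x y(1) by (simp add: m_ac)
    also have "\<dots> = \<one>" using x y by (simp add: inv_square square_square)
    finally have "inv x \<otimes> y \<in> two_torsion" using x y unfolding two_torsion_def by simp
    moreover have "y = x \<otimes> (inv x \<otimes> y)" using x y by (simp add: m_assoc[symmetric])
    ultimately show "y \<in> (\<lambda>u. x \<otimes> u) ` two_torsion" by blast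
  next
    fix y assume "y \<in> (\<lambda>u. x \<otimes> u) ` two_torsion"
    then obtain u where u: "u \<in> two_torsion" "y = x \<otimes> u" by blast
    have "y \<otimes> y = (x \<otimes> x) \<otimes> (u \<otimes> u)" using x u by (simp add: m_ac)
    then have "y \<otimes> y = x \<otimes> x" using x u by (simp add: two_torsion_square)
    moreover have "y \<notin> two_torsion" using calculation order_4_square_neq_one[OF x(1)]
      unfolding two_torsion_def by auto
    ultimately show "y \<in> square_roots t" using x u by (simp add: square_roots_def)
  qed
  moreover have "inj_on (\<lambda>u. x \<otimes> u) two_torsion"
    using x by (auto simp: inj_on_def)
  ultimately show ?thesis using True by (simp add: card_image)
next
  case False
  then have "square_roots t = {}" by (auto simp: square_roots_def squares_def)
  with False show ?thesis by simp
qed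

text \<open>The fibres of squaring partition \<open>order_4\<close>, and each is a coset of the
  two-torsion.\<close>

lemma card_order_4: "card order_4 = card two_torsion * card squares"
proof -
  have "order_4 = (\<Union>t\<in>squares. square_roots t)"
    by (auto simp: squares_def square_roots_def)
  also have "card \<dots> = (\<Sum>t\<in>squares. card (square_roots t))"
    by (rule card_UN_disjoint) (simp, simp, auto simp: square_roots_def)
  also have "\<dots> = card two_torsion * card squares" by (simp add: card_square_roots)
  finally show ?thesis .
qed

text \<open>For the concrete group this is solved for \<open>card squares\<close>, the other two
  cardinalities being known.\<close>

lemma card_carrier: "card (carrier G) = card two_torsion * (card squares + 1)"
proof -
  have "card (carrier G) = card two_torsion + card order_4"
    using finite_carrier card_mono[of "carrier G" two_torsion]
    by (subst card_Diff_subset) (auto simp: subset_iff)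
  then show ?thesis by (simp add: card_order_4)
qed

section \<open>Elimination of the elements of order 4\<close>

context
  fixes X :: real
begin

text \<open>The entries of \<open>X I - L\<close> for the Laplacian \<open>L\<close> of the power
  graph.\<close>

definition entry :: "'a \<Rightarrow> 'a \<Rightarrow> real" where
  "entry x y = (if x = y then X - real (card {z. adjacent x z}) else if adjacent x y then 1 else 0)"

definition reduced_entry :: "'a \<Rightarrow> 'a \<Rightarrow> real" where
  "reduced_entry x z = entry x z - (\<Sum>y\<in>order_4. entry x y * (entry y z / (X - 2)))"

lemma entry_order_4:
  assumes "x \<in> order_4" "y \<in> order_4"
  shows "entry x y = (if y = x then X - 3 else if y = inv x then 1 else 0)"
  using assms card_neighbours_order_4[OF assms(1)] adjacent_order_4[OF assms] by (simp add: entry_def)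

text \<open>Twins: \<open>x\<close> and \<open>inv x\<close> have the same square, so they see the
  same vertices of the two-torsion.\<close>

lemma entry_inv:
  assumes "x \<in> order_4" "z \<in> two_torsion"
  shows "entry (inv x) z = entry x z"
proof -
  have ix: "inv x \<in> order_4" using inv_order_4 assms by blast
  have "adjacent (inv x) z \<longleftrightarrow> adjacent x z"
  proof (cases "z = \<one>")
    case True
    have "adjacent \<one> (inv x)" "adjacent \<one> x"
      using assms(1) ix by (auto simp: adjacent_one)
    then show ?thesis using True adjacent_sym by blast
  next
    case False
    then have "adjacent z (inv x) \<longleftrightarrow> adjacent z x"
      using assms ix by (simp add: adjacent_two_torsion_order_4 square_roots_def inv_square)
    then show ?thesis using adjacent_sym by blast
  qed
  moreover have "inv x \<noteq> z" "x \<noteq> z" using ix assms by auto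
  ultimately show ?thesis by (simp add: entry_def)
qed

text \<open>Inversion pairs up the \<open>2 * m * card squares\<close> elements of
  \<open>order_4\<close>; the diagonal entry \<open>X - 3\<close> reflects their degree 3 and has to
  be a nonzero pivot.\<close>

lemma det_on_order_4:
  assumes "X \<noteq> 3" "card two_torsion = 2 * m"
  shows "det_on order_4 entry = ((X - 2) * (X - 4)) ^ (m * card squares)"
proof -
  have "det_on order_4 entry = ((X - 3)\<^sup>2 - 1\<^sup>2) ^ (m * card squares)"
    by (rule det_on_involution[where \<iota> = "m_inv G"])
      (use assms inv_order_4 entry_order_4 in \<open>auto simp: card_order_4\<close>)
  also have "(X - 3)\<^sup>2 - 1\<^sup>2 = (X - 2) * (X - 4)"
    by (simp add: power2_eq_square algebra_simps)
  finally show ?thesis .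
qed

text \<open>By \<open>entry_inv\<close>, each column indexed by the two-torsion is constant on the
  pairs \<open>{x, inv x}\<close>. It is therefore an eigenvector of the \<open>order_4\<close>
  block with eigenvalue \<open>(X - 3) + 1 = X - 2\<close>, and dividing it by \<open>X - 2\<close>
  solves the linear system.\<close>

lemma eliminate_order_4:
  assumes "X \<noteq> 2"
  shows "det_on (carrier G) entry = det_on order_4 entry * det_on two_torsion reduced_entry"
proof -
  have "det_on (order_4 \<union> two_torsion) entry = det_on order_4 entry *
      det_on two_torsion (\<lambda>x z. entry x z - (\<Sum>y\<in>order_4. entry x y * (entry y z / (X - 2))))"
  proof (rule det_on_schur_complement)
    fix x z assume x: "x \<in> order_4" and z: "z \<in> two_torsion"
    have ix: "inv x \<in> order_4" "x \<noteq> inv x" using inv_order_4[OF x] by auto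
    have "(\<Sum>y\<in>order_4. entry x y * (entry y z / (X - 2))) =
        (\<Sum>y\<in>{x, inv x}. entry x y * (entry y z / (X - 2)))"
      by (rule sum.mono_neutral_right) (use x ix in \<open>auto simp: entry_order_4\<close>)
    also have "\<dots> = (X - 3) * (entry x z / (X - 2)) + entry x z / (X - 2)"
      using ix x by (simp add: entry_order_4 entry_inv[OF x z])
    also have "\<dots> = (X - 2) * entry x z / (X - 2)"
      by (simp add: add_divide_distrib[symmetric] algebra_simps)
    also have "\<dots> = entry x z" using assms by simp
    finally show "(\<Sum>y\<in>order_4. entry x y * (entry y z / (X - 2))) = entry x z" .
  qed auto
  moreover have "order_4 \<union> two_torsion = carrier G" by auto
  ultimately show ?thesis by (simp add: reduced_entry_def[abs_def])
qed

section \<open>The reduced matrix on the two-torsion\<close>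

definition order_4_neighbours :: "'a \<Rightarrow> 'a set" where
  "order_4_neighbours x = (if x = \<one> then order_4 else square_roots x)"

lemma entry_two_torsion_order_4:
  assumes "x \<in> two_torsion" "y \<in> order_4"
  shows "entry x y = of_bool (y \<in> order_4_neighbours x)"
    and "entry y x = of_bool (y \<in> order_4_neighbours x)"
proof -
  have "adjacent x y \<longleftrightarrow> y \<in> order_4_neighbours x"
    using assms adjacent_two_torsion_order_4[of x y]
    by (cases "x = \<one>") (auto simp: adjacent_one order_4_neighbours_def)
  then show "entry x y = of_bool (y \<in> order_4_neighbours x)"
    and "entry y x = of_bool (y \<in> order_4_neighbours x)"
    using assms adjacent_sym[of y x] by (auto simp: entry_def)
qed

text \<open>All entries between the two-torsion and \<open>order_4\<close> are 0 or 1, so the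
  correction sum counts common neighbours of order 4.\<close>

lemma reduced_entry_two_torsion:
  assumes "x \<in> two_torsion" "z \<in> two_torsion"
  shows "reduced_entry x z =
    entry x z - real (card (order_4_neighbours x \<inter> order_4_neighbours z)) / (X - 2)"
proof -
  let ?S = "order_4_neighbours x \<inter> order_4_neighbours z"
  have "(\<Sum>y\<in>order_4. entry x y * (entry y z / (X - 2))) = (\<Sum>y\<in>order_4. if y \<in> ?S then 1 / (X - 2) else 0)"
    using assms by (intro sum.cong refl) (auto simp: entry_two_torsion_order_4)
  also have "\<dots> = (\<Sum>y\<in>order_4 \<inter> ?S. 1 / (X - 2))"
    by (rule sum.inter_restrict[symmetric]) simp
  also have "order_4 \<inter> ?S = ?S"
    by (auto simp: order_4_neighbours_def square_roots_def)
  finally show ?thesis by (simp add: reduced_entry_def)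
qed

lemma square_roots_order_4:
  "order_4 \<inter> square_roots x = square_roots x"
  "square_roots x \<inter> order_4 = square_roots x"
  by (auto simp: square_roots_def)

lemma reduced_entry_diag:
  assumes "t \<in> two_torsion - {\<one>}"
  shows "reduced_entry t t =
    X - 1 - real (card (square_roots t)) - real (card (square_roots t)) / (X - 2)"
proof -
  have "\<one> \<notin> square_roots t" by (auto simp: square_roots_def)
  then have "card {y. adjacent t y} = 1 + card (square_roots t)"
    using neighbours_two_torsion[OF assms] by simp
  then show ?thesis
    using assms by (simp add: reduced_entry_two_torsion order_4_neighbours_def entry_def)
qed

lemma reduced_entry_one:
  assumes "t \<in> two_torsion - {\<one>}"
  shows "reduced_entry t \<one> = 1 - real (card (square_roots t)) / (X - 2)"
    and "reduced_entry \<one> t = 1 - real (card (square_roots t)) / (X - 2)"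
proof -
  have "adjacent \<one> t" "adjacent t \<one>" using assms adjacent_one adjacent_sym by auto
  then show "reduced_entry t \<one> = 1 - real (card (square_roots t)) / (X - 2)"
    and "reduced_entry \<one> t = 1 - real (card (square_roots t)) / (X - 2)"
    using assms by (auto simp: reduced_entry_two_torsion order_4_neighbours_def square_roots_order_4 entry_def)
qed

lemma reduced_entry_one_one:
  "reduced_entry \<one> \<one> = X - real (card (carrier G) - 1) - real (card order_4) / (X - 2)"
  using finite_carrier by (simp add: reduced_entry_two_torsion order_4_neighbours_def entry_def neighbours_one)

text \<open>Distinct involutions are not adjacent and have no common square root, so elimination
  creates no coupling between them.\<close>

lemma reduced_entry_off_diag:
  assumes "t \<in> two_torsion - {\<one>}" "u \<in> two_torsion - {\<one>}" "t \<noteq> u"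
  shows "reduced_entry t u = 0"
proof -
  have *: "square_roots t \<inter> square_roots u = {}"
    using assms by (auto simp: square_roots_def)
  show ?thesis
    using assms adjacent_two_torsion[OF assms(1,2)] *
    by (simp add: reduced_entry_two_torsion order_4_neighbours_def entry_def)
qed

lemma reduced_entry_diag_cases:
  assumes "t \<in> two_torsion - {\<one>}" "X \<noteq> 2"
  shows "reduced_entry t t = (if t \<in> squares
    then (X - 1) * (X - 2 - real (card two_torsion)) / (X - 2) else X - 1)"
proof -
  have "X - 1 - c - c / (X - 2) = (X - 1) * (X - 2 - c) / (X - 2)" for c
    using assms(2) by (simp add: field_simps)
  then show ?thesis
    using assms(2) by (simp only: reduced_entry_diag[OF assms(1)] card_square_roots) simp
qed

text \<open>The involutions form a diagonal block, whose entries depend only on being a square or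
  not. Eliminating them leaves one entry at the identity, the last factor. The excluded values of
  \<open>X\<close> keep the pivots and denominators nonzero.\<close>

lemma det_on_two_torsion:
  assumes X: "X \<noteq> 1" "X \<noteq> 2" "X \<noteq> 2 + real (card two_torsion)"
  shows "det_on two_torsion reduced_entry =
    ((X - 1) * (X - 2 - real (card two_torsion)) / (X - 2)) ^ card squares
      * (X - 1) ^ (card two_torsion - 1 - card squares)
      * (X * (X - real (card (carrier G))) / (X - 1))"
proof -
  let ?c = "real (card two_torsion)" and ?k = "real (card squares)" and ?N = "real (card (carrier G))"
  let ?I = "two_torsion - {\<one>}"
  let ?D = "(X - 1) * (X - 2 - ?c) / (X - 2)"
  have D: "?D \<noteq> 0" using X by simp
  have nz: "reduced_entry t t \<noteq> 0" if "t \<in> ?I" for t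
    using reduced_entry_diag_cases[OF that X(2)] D X(1) by simp
  have split: "?I = squares \<union> (?I - squares)" using squares_subset by blast
  have cardQ: "card (?I - squares) = card two_torsion - 1 - card squares"
    using squares_subset by (simp add: card_Diff_subset)
  \<comment> \<open>The identity lies in the two-torsion but is no square of an element of order 4;
    this keeps the natural subtraction in \<open>cardQ\<close> from truncating.\<close>
  have le: "card squares + 1 \<le> card two_torsion"
  proof -
    have "card (insert \<one> squares) \<le> card two_torsion"
      using squares_subset by (intro card_mono) auto
    moreover have "\<one> \<notin> squares" using squares_subset by blast
    ultimately show ?thesis by simp
  qed
  have N: "?N = ?c * (?k + 1)" by (simp add: card_carrier algebra_simps)
  have "card (carrier G) \<ge> 1"
    using finite_carrier one_closed card_gt_0_iff[of "carrier G"] by fastforce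
  then have N1: "real (card (carrier G) - 1) = ?N - 1" by simp

  have diag: "det_on ?I reduced_entry = ?D ^ card squares * (X - 1) ^ (card two_torsion - 1 - card squares)"
  proof -
    have "det_on ?I reduced_entry = (\<Prod>t\<in>?I. reduced_entry t t)"
      by (rule det_on_diagonal) (auto simp: reduced_entry_off_diag)
    also have "\<dots> = (\<Prod>t\<in>squares. reduced_entry t t) * (\<Prod>t\<in>?I - squares. reduced_entry t t)"
      by (subst split, rule prod.union_disjoint) auto
    also have "(\<Prod>t\<in>squares. reduced_entry t t) = (\<Prod>t\<in>squares. ?D)"
    proof (intro prod.cong refl)
      fix t assume t: "t \<in> squares"
      then have "t \<in> ?I" using squares_subset by blast
      then show "reduced_entry t t = ?D" using reduced_entry_diag_cases[OF _ X(2)] t by simp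
    qed
    also have "(\<Prod>t\<in>?I - squares. reduced_entry t t) = (\<Prod>t\<in>?I - squares. X - 1)"
      by (intro prod.cong refl) (simp add: reduced_entry_diag_cases[OF _ X(2)])
    finally show ?thesis by (simp add: cardQ)
  qed

  \<comment> \<open>The pivot \<open>?D\<close> contains the factor \<open>X - 2 - ?c\<close> once
    and the numerator twice, so one copy survives.\<close>
  have *: "(1 - ?c / (X - 2)) * ((1 - ?c / (X - 2)) / ?D) = (X - 2 - ?c) / ((X - 1) * (X - 2))"
    using X by (simp add: divide_simps)
  have summand: "reduced_entry \<one> t * (reduced_entry t \<one> / reduced_entry t t) =
      (if t \<in> squares then (X - 2 - ?c) / ((X - 1) * (X - 2)) else 1 / (X - 1))" if "t \<in> ?I" for t
    using reduced_entry_diag_cases[OF that X(2)] reduced_entry_one[OF that] *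
    by (simp add: card_square_roots mult.assoc)
  have "(\<Sum>t\<in>?I. reduced_entry \<one> t * (reduced_entry t \<one> / reduced_entry t t)) =
      (\<Sum>t\<in>squares. reduced_entry \<one> t * (reduced_entry t \<one> / reduced_entry t t)) +
      (\<Sum>t\<in>?I - squares. reduced_entry \<one> t * (reduced_entry t \<one> / reduced_entry t t))"
    by (subst split, rule sum.union_disjoint) auto
  also have "(\<Sum>t\<in>squares. reduced_entry \<one> t * (reduced_entry t \<one> / reduced_entry t t)) =
      (\<Sum>t\<in>squares. (X - 2 - ?c) / ((X - 1) * (X - 2)))"
  proof (intro sum.cong refl)
    fix t assume t: "t \<in> squares"
    then have "t \<in> ?I" using squares_subset by blast
    from summand[OF this] t
    show "reduced_entry \<one> t * (reduced_entry t \<one> / reduced_entry t t) = (X - 2 - ?c) / ((X - 1) * (X - 2))"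
      by simp
  qed
  also have "(\<Sum>t\<in>?I - squares. reduced_entry \<one> t * (reduced_entry t \<one> / reduced_entry t t)) =
      (\<Sum>t\<in>?I - squares. 1 / (X - 1))"
    by (intro sum.cong refl) (simp add: summand del: times_divide_eq_right times_divide_eq_left)
  finally have sum: "(\<Sum>t\<in>?I. reduced_entry \<one> t * (reduced_entry t \<one> / reduced_entry t t)) =
      ?k * ((X - 2 - ?c) / ((X - 1) * (X - 2))) + (?c - 1 - ?k) * (1 / (X - 1))"
    using le by (simp add: cardQ of_nat_diff)

  have "det_on (?I \<union> {\<one>}) reduced_entry = det_on ?I reduced_entry * det_on {\<one>}
      (\<lambda>x z. reduced_entry x z - (\<Sum>y\<in>?I. reduced_entry x y * (reduced_entry y z / reduced_entry y y)))"
  \<comment> \<open>The block on \<open>?I\<close> is diagonal, so its system is solved by dividing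
    by the diagonal entries.\<close>
  proof (rule det_on_schur_complement)
    fix x z assume x: "x \<in> ?I" and "z \<in> {\<one>}"
    have "(\<Sum>y\<in>?I. reduced_entry x y * (reduced_entry y z / reduced_entry y y)) =
        (\<Sum>y\<in>{x}. reduced_entry x y * (reduced_entry y z / reduced_entry y y))"
      by (rule sum.mono_neutral_right) (use x in \<open>auto simp: reduced_entry_off_diag\<close>)
    then show "(\<Sum>y\<in>?I. reduced_entry x y * (reduced_entry y z / reduced_entry y y)) = reduced_entry x z"
      using nz[OF x] by simp
  qed auto
  moreover have "?I \<union> {\<one>} = two_torsion" by auto
  \<comment> \<open>After multiplication by \<open>X - 1\<close> the terms with denominator
    \<open>X - 2\<close> combine to a constant, and \<open>N\<close> cancels the remaining constant
    term, which exposes the root \<open>X = 0\<close>.\<close>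
  moreover have "reduced_entry \<one> \<one> - (\<Sum>t\<in>?I. reduced_entry \<one> t * (reduced_entry t \<one> / reduced_entry t t))
      = X * (X - ?N) / (X - 1)"
    unfolding sum reduced_entry_one_one N1 card_order_4 of_nat_mult N
    using X by (simp add: divide_simps) (simp add: algebra_simps)
  ultimately show ?thesis by (simp add: diag)
qed

end

section \<open>From values at large arguments to a polynomial identity\<close>

theorem laplacian_poly_power_graph:
  assumes vs: "distinct vs" "set vs = carrier G"
    and c: "card two_torsion = 2 * m" "m > 0"
  shows "laplacian_poly (power_graph G) vs =
    [:0, 1:] * [:-1, 1:] ^ (2 * m - 2)
      * [:-2, 1:] ^ (card squares * (m - 1))
      * [:-4, 1:] ^ (m * card squares)
      * [:- (2 + 2 * real m), 1:] ^ card squares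
      * [:- real (card (carrier G)), 1:]" (is "?L = ?R")
proof -
  \<comment> \<open>The bound avoids the excluded values 1, 2, 3 and \<open>2 + 2 * m\<close>
    together, yet leaves infinitely many arguments.\<close>
  have *: "poly (?L - ?R) X = 0" if X: "X > 4 + 2 * real m" for X
  proof -
    let ?k = "card squares"
    have "irrefl (parcs (power_graph G))"
      by (auto simp: irrefl_def power_graph_def)
    then have "poly ?L X = det_on (carrier G) (entry X)"
      using poly_laplacian_poly[OF vs(1)] vs(2) by (simp add: entry_def[abs_def])
    also have "\<dots> = ((X - 2) * (X - 4)) ^ (m * ?k) *
      (((X - 1) * (X - 2 - 2 * real m) / (X - 2)) ^ ?k
      * (X - 1) ^ (2 * m - 1 - ?k) * (X * (X - real (card (carrier G))) / (X - 1)))"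
      using X c(1) by (simp add: eliminate_order_4 det_on_order_4 det_on_two_torsion)
    also have "\<dots> = poly ?R X"
    proof -
      have "card squares \<le> 2 * m - 1"
        using card_mono[OF _ squares_subset] c by simp
      \<comment> \<open>The exponents of \<open>X - 1\<close> add up to \<open>2 * m - 1\<close>;
        one factor is set apart to cancel the denominator of the entry at the identity.\<close>
      then have p1: "(X - 1) ^ ?k * (X - 1) ^ (2 * m - 1 - ?k) = (X - 1) ^ (2 * m - 2) * (X - 1)"
        using c(2) by (cases m) (simp_all add: power_add[symmetric])
      \<comment> \<open>The \<open>?k\<close> denominators \<open>X - 2\<close> coming from the
        squares are absorbed by the determinant of the \<open>order_4\<close> block.\<close>
      have p2: "(X - 2) ^ (m * ?k) = (X - 2) ^ (?k * (m - 1)) * (X - 2) ^ ?k"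
        using c(2) by (simp add: power_add[symmetric]) (cases m; simp add: algebra_simps)
      have "((X - 2) * (X - 4)) ^ (m * ?k) *
          (((X - 1) * (X - 2 - 2 * real m) / (X - 2)) ^ ?k
          * (X - 1) ^ (2 * m - 1 - ?k) * (X * (X - real (card (carrier G))) / (X - 1))) =
        (X - 2) ^ (m * ?k) / (X - 2) ^ ?k * (X - 4) ^ (m * ?k) * (X - 2 - 2 * real m) ^ ?k
          * ((X - 1) ^ ?k * (X - 1) ^ (2 * m - 1 - ?k) / (X - 1)) * (X * (X - real (card (carrier G))))"
        by (simp add: power_mult_distrib power_divide)
      also have "\<dots> = (X - 2) ^ (?k * (m - 1)) * (X - 4) ^ (m * ?k) * (X - 2 - 2 * real m) ^ ?k
          * (X - 1) ^ (2 * m - 2) * (X * (X - real (card (carrier G))))"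
        unfolding p1 p2 using X by simp
      also have "\<dots> = poly ?R X"
        by (simp add: poly_power algebra_simps)
      finally show ?thesis .
    qed
    finally show ?thesis by simp
  qed
  have "?L - ?R = 0"
  proof (rule ccontr)
    assume "?L - ?R \<noteq> 0"
    then have "finite {X. poly (?L - ?R) X = 0}" by (rule poly_roots_finite)
    then have "finite {4 + 2 * real m<..}"
      by (rule rev_finite_subset) (use * in auto)
    then show False using infinite_Ioi by blast
  qed
  then show ?thesis by simp
qed

end

subsection \<open>The group \<open>\<int>\<^sub>2\<^sup>r \<times> \<int>\<^sub>4\<^sup>s\<close>\<close>

lemma comm_group_cyclic_power: "comm_group (cyclic_power k t)"
  by (rule group.group_comm_groupI[OF group_cyclic_power])
    (auto simp: cyclic_power_def add.commute)

lemma carrier_cyclic_power: "k > 0 \<Longrightarrow> carrier (cyclic_power k t) = {..<t} \<rightarrow>\<^sub>E {0..<int k}"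
  by (simp add: cyclic_power_def carrier_integer_mod_group)

lemma mult_cyclic_power: "x \<otimes>\<^bsub>cyclic_power k t\<^esub> y = (\<lambda>i\<in>{..<t}. (x i + y i) mod int k)"
  by (simp add: cyclic_power_def)

lemma one_cyclic_power: "\<one>\<^bsub>cyclic_power k t\<^esub> = (\<lambda>i\<in>{..<t}. 0)"
  by (simp add: cyclic_power_def)

lemma card_carrier_cyclic_power: "k > 0 \<Longrightarrow> card (carrier (cyclic_power k t)) = k ^ t"
  by (simp add: carrier_cyclic_power card_PiE)

lemma cyclic_power_2_square:
  "x \<otimes>\<^bsub>cyclic_power 2 t\<^esub> x = \<one>\<^bsub>cyclic_power 2 t\<^esub>"
  by (simp add: mult_cyclic_power one_cyclic_power)

lemma nat_pow_cyclic_power: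
  "x [^]\<^bsub>cyclic_power k t\<^esub> (n::nat) = (\<lambda>i\<in>{..<t}. (int n * x i) mod int k)"
proof (induction n)
  case (Suc n)
  then show ?case
    by (auto simp: mult_cyclic_power fun_eq_iff mod_add_right_eq algebra_simps)
qed (simp add: one_cyclic_power)

lemma nat_pow_cyclic_power_eq_one:
  fixes n :: nat
  assumes "k dvd n"
  shows "x [^]\<^bsub>cyclic_power k t\<^esub> n = \<one>\<^bsub>cyclic_power k t\<^esub>"
  using assms by (auto simp: nat_pow_cyclic_power one_cyclic_power fun_eq_iff elim!: dvdE)

text \<open>Modulo 4 exactly 0 and 2 double to 0; the function-space form lets
  \<open>card_PiE\<close> count the solutions.\<close>

lemma cyclic_power_4_two_torsion:
  "{x \<in> carrier (cyclic_power 4 t). x \<otimes>\<^bsub>cyclic_power 4 t\<^esub> x = \<one>\<^bsub>cyclic_power 4 t\<^esub>} = {..<t} \<rightarrow>\<^sub>E {0, 2}"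
proof -
  have *: "(u + u) mod 4 = 0 \<longleftrightarrow> u \<in> {0, 2}" if "u \<in> {0..<4}" for u :: int
    using that by auto
  have "x \<otimes>\<^bsub>cyclic_power 4 t\<^esub> x = \<one>\<^bsub>cyclic_power 4 t\<^esub> \<longleftrightarrow> x \<in> {..<t} \<rightarrow>\<^sub>E {0, 2}"
    if x: "x \<in> {..<t} \<rightarrow>\<^sub>E {0..<4}" for x
  proof -
    have "x \<otimes>\<^bsub>cyclic_power 4 t\<^esub> x = \<one>\<^bsub>cyclic_power 4 t\<^esub> \<longleftrightarrow> (\<forall>i<t. (x i + x i) mod 4 = 0)"
      by (auto simp: mult_cyclic_power one_cyclic_power fun_eq_iff restrict_def)
    also have "\<dots> \<longleftrightarrow> (\<forall>i<t. x i \<in> {0, 2})"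
      using x * by (metis PiE_mem lessThan_iff)
    finally show ?thesis using x by (auto simp: PiE_iff)
  qed
  moreover have "{..<t} \<rightarrow>\<^sub>E {0, 2} \<subseteq> {..<t} \<rightarrow>\<^sub>E {0..<4::int}"
    by (intro PiE_mono) auto
  ultimately show ?thesis by (auto simp: carrier_cyclic_power)
qed

lemma DirProd_nat_pow: "(x, y) [^]\<^bsub>G \<times>\<times> H\<^esub> (n::nat) = (x [^]\<^bsub>G\<^esub> n, y [^]\<^bsub>H\<^esub> n)"
  by (induction n) auto

lemma exponent_4_group_DirProd:
  "exponent_4_group (cyclic_power 2 r \<times>\<times> cyclic_power 4 s)"
proof -
  let ?A = "cyclic_power 2 r" and ?B = "cyclic_power 4 s"
  have "group (?A \<times>\<times> ?B)"
    by (intro DirProd_group group_cyclic_power)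
  then show ?thesis
    unfolding exponent_4_group_def exponent_4_group_axioms_def
    by (auto simp: finite_carrier_cyclic_power DirProd_nat_pow nat_pow_cyclic_power_eq_one
        comm_groupE(4)[OF comm_group_cyclic_power] intro!: group.group_comm_groupI)
qed

theorem theorem3p12:
  fixes r s :: nat
    and vs :: "((nat \<Rightarrow> int) \<times> (nat \<Rightarrow> int)) list"
  defines "G \<equiv> cyclic_power 2 r \<times>\<times> cyclic_power 4 s"
  assumes "r > 0" and "s > 0"
    and "distinct vs" and "set vs = pverts (power_graph G)"
  shows "laplacian_poly (power_graph G) vs =
    [:0, 1:] * [:-1, 1:] ^ (2 ^ (r + s) - 2)
      * [:-2, 1:] ^ ((2 ^ s - 1) * (2 ^ (r + s - 1) - 1))
      * [:-4, 1:] ^ (2 ^ (r + s - 1) * (2 ^ s - 1))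
      * [:- (2 + 2 ^ (r + s)), 1:] ^ (2 ^ s - 1)
      * [:- (2 ^ (r + 2 * s)), 1:]"
proof -
  interpret exponent_4_group G
    unfolding G_def by (rule exponent_4_group_DirProd)
  \<comment> \<open>Half the size of the two-torsion; \<open>r > 0\<close> makes
    \<open>r + s - 1\<close> a true predecessor.\<close>
  define m :: nat where "m = 2 ^ (r + s - 1)"
  have m: "2 * m = 2 ^ (r + s)" "m > 0"
    using \<open>r > 0\<close> by (auto simp: m_def power_Suc[symmetric] simp del: power_Suc)
  have "two_torsion = carrier (cyclic_power 2 r) \<times> ({..<s} \<rightarrow>\<^sub>E {0, 2})"
    unfolding two_torsion_def cyclic_power_4_two_torsion[symmetric] unfolding G_def
    by (auto simp: cyclic_power_2_square)
  moreover have "card ({..<s} \<rightarrow>\<^sub>E {0, 2 :: int}) = 2 ^ s"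
    by (simp add: card_PiE numeral_2_eq_2)
  ultimately have c: "card two_torsion = 2 * m"
    by (simp add: card_cartesian_product card_carrier_cyclic_power m power_add)
  have N: "card (carrier G) = 2 ^ (r + 2 * s)"
    by (simp add: G_def card_cartesian_product card_carrier_cyclic_power power_add power_mult)
  \<comment> \<open>Both sides are the group order: cancelling the size of the two-torsion yields
    the number of squares.\<close>
  have "2 ^ (r + s) * (card squares + 1) = 2 ^ (r + s) * (2 ^ s :: nat)"
    using card_carrier N c m by (simp add: power_add mult_2)
  then have "card squares + 1 = 2 ^ s"
    by (metis mult_left_cancel power_not_zero zero_neq_numeral)
  then have k: "card squares = 2 ^ s - 1" by simp
  have rm: "2 * real m = 2 ^ (r + s)"
    using m(1) by (metis of_nat_mult of_nat_numeral of_nat_power)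
  have "set vs = carrier G" using assms(5) by (simp add: power_graph_def)
  from laplacian_poly_power_graph[OF assms(4) this c m(2)]
  show ?thesis unfolding k N rm m(1) by (simp add: m_def)
qed

end
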